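(* Let $H:=\{x+iy: x>-14\log_+|y|\}$, let $\Psi:T\to H$ be a model function, and set $g:=\exp\circ\Psi:T\to\mathbb{C}$. Let $f\in\mathcal{B}$ be an entire function such that, as $z\to\infty$, $f(z)=g(z)+O(1/z)$ for $z\in T$ and $f(z)=O(1/z)$ for $z\notin T$. Then for every sufficiently large $R>0$ there exists a quasiconformal homeomorphism $\phi:\mathbb{C}\to\mathbb{C}$ such that $$g(z)=f(\phi(z))$$ for all $z$ (in the domain $T$ of $g$) with $|g(z)|\ge R$. This map is asymptotically conformal at $\infty$; more precisely, $\phi(z)=z+O(1)$ as $z\to\infty$.
   Context: $\log_+(t):=\max(0,\log t)$ for $t\ge 0$, and $\mathbb{H}:=\{z\in\mathbb{C}:\operatorname{Re}z>0\}$. A model function is a conformal isomorphism $\Psi:T\to H$, where $T\subset\mathbb{C}$ is an unbounded simply-connected domain, $H$ is a simply-connected domain with $\mathbb{H}\subset H$, and whenever $z_n\in T$ is a sequence with $\Psi(z_n)\to\infty$, then $z_n\to\infty$. The Eremenko-Lyubich class $\mathcal{B}$ is the set of transcendental entire functions $f$ for which the set $\operatorname{sing}(f^{-1})$ of critical and (finite) asymptotic values is bounded. *)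

theory Defs
  imports "HOL-Complex_Analysis.Complex_Analysis" "HOL-Library.Landau_Symbols"
begin

text \<open>Since \<open>ln 0 = 0\<close> in HOL, this gives the intended value \<open>0\<close> at \<open>t = 0\<close>.\<close>

definition log_plus :: "real \<Rightarrow> real" where
  "log_plus t = max 0 (ln t)"

definition conformal_isomorphism :: "(complex \<Rightarrow> complex) \<Rightarrow> complex set \<Rightarrow> complex set \<Rightarrow> bool" where
  "conformal_isomorphism \<Psi> T H \<longleftrightarrow> \<Psi> holomorphic_on T \<and> bij_betw \<Psi> T H"

definition model_function :: "(complex \<Rightarrow> complex) \<Rightarrow> complex set \<Rightarrow> complex set \<Rightarrow> bool" where
  "model_function \<Psi> T H \<longleftrightarrow>
     open T \<and> connected T \<and> simply_connected T \<and> \<not> bounded T \<and>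
     open H \<and> connected H \<and> simply_connected H \<and> {z. Re z > 0} \<subseteq> H \<and>
     conformal_isomorphism \<Psi> T H \<and>
     (\<forall>z :: nat \<Rightarrow> complex. (\<forall>n. z n \<in> T) \<longrightarrow>
        filterlim (\<lambda>n. \<Psi> (z n)) at_infinity sequentially \<longrightarrow>
        filterlim z at_infinity sequentially)"

definition transcendental_entire :: "(complex \<Rightarrow> complex) \<Rightarrow> bool" where
  "transcendental_entire f \<longleftrightarrow> f holomorphic_on UNIV \<and> \<not> (\<exists>p. \<forall>z. f z = poly p z)"

definition critical_values :: "(complex \<Rightarrow> complex) \<Rightarrow> complex set" where
  "critical_values f = f ` {c. deriv f c = 0}"

definition asymptotic_values :: "(complex \<Rightarrow> complex) \<Rightarrow> complex set" where
  "asymptotic_values f =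
     {a. \<exists>\<gamma> :: real \<Rightarrow> complex. continuous_on {0..} \<gamma> \<and>
           filterlim \<gamma> at_infinity at_top \<and> ((\<lambda>t. f (\<gamma> t)) \<longlongrightarrow> a) at_top}"

definition eremenko_lyubich_class :: "(complex \<Rightarrow> complex) set" where
  "eremenko_lyubich_class =
     {f. transcendental_entire f \<and> bounded (critical_values f \<union> asymptotic_values f)}"

text \<open>
  Absolute continuity in the epsilon-delta sense. A division consists of nonoverlapping
  nonempty compact intervals \<open>K = {Inf K..Sup K}\<close>.
\<close>

definition abs_continuous_on_interval :: "real \<Rightarrow> real \<Rightarrow> (real \<Rightarrow> complex) \<Rightarrow> bool" where
  "abs_continuous_on_interval a b f \<longleftrightarrow>
     (\<forall>\<epsilon>>0. \<exists>\<delta>>0. \<forall>\<D> S. \<D> division_of S \<longrightarrow> S \<subseteq> {a..b} \<longrightarrow>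
        (\<Sum>K\<in>\<D>. Sup K - Inf K) < \<delta> \<longrightarrow>
        (\<Sum>K\<in>\<D>. cmod (f (Sup K) - f (Inf K))) < \<epsilon>)"

text \<open>Absolute continuity on lines, tested on all closed rectangles in \<open>U\<close>.\<close>

definition acl_on :: "complex set \<Rightarrow> (complex \<Rightarrow> complex) \<Rightarrow> bool" where
  "acl_on U \<phi> \<longleftrightarrow>
     (\<forall>a b. cbox a b \<subseteq> U \<longrightarrow>
        (AE y in lborel. y \<in> {Im a..Im b} \<longrightarrow>
           abs_continuous_on_interval (Re a) (Re b) (\<lambda>x. \<phi> (Complex x y))) \<and>
        (AE x in lborel. x \<in> {Re a..Re b} \<longrightarrow>
           abs_continuous_on_interval (Im a) (Im b) (\<lambda>y. \<phi> (Complex x y))))"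

text \<open>
  Ahlfors' analytic definition: a homeomorphism that is absolutely continuous on lines and
  whose partial derivatives \<open>p\<close> and \<open>q\<close> in the directions \<open>1\<close> and \<open>\<i>\<close> satisfy
  \<open>\<bar>\<partial>\<phi>/\<partial>z*\<bar> \<le> k \<bar>\<partial>\<phi>/\<partial>z\<bar>\<close> almost everywhere for some \<open>k < 1\<close>, where \<open>z*\<close> is the conjugate
  of \<open>z\<close>, \<open>\<partial>\<phi>/\<partial>z = (p - \<i> q) / 2\<close> and \<open>\<partial>\<phi>/\<partial>z* = (p + \<i> q) / 2\<close>. The inequality makes such
  maps preserve orientation.
\<close>

definition quasiconformal :: "complex set \<Rightarrow> complex set \<Rightarrow> (complex \<Rightarrow> complex) \<Rightarrow> bool" where
  "quasiconformal U V \<phi> \<longleftrightarrow>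
     (\<exists>\<psi>. homeomorphism U V \<phi> \<psi>) \<and> acl_on U \<phi> \<and>
     (\<exists>k. 0 \<le> k \<and> k < 1 \<and>
        (AE z in lborel. z \<in> U \<longrightarrow>
           (\<exists>p q. ((\<lambda>t. \<phi> (z + of_real t)) has_vector_derivative p) (at 0) \<and>
                  ((\<lambda>t. \<phi> (z + \<i> * of_real t)) has_vector_derivative q) (at 0) \<and>
                  cmod ((p + \<i> * q) / 2) \<le> k * cmod ((p - \<i> * q) / 2))))"

text \<open>Angle preservation at infinity itself, as opposed to the condition that the dilatation
  of \<open>\<phi>\<close> tends to \<open>1\<close> there.\<close>

definition asymptotically_conformal_at_infinity :: "(complex \<Rightarrow> complex) \<Rightarrow> bool" where
  "asymptotically_conformal_at_infinity \<phi> \<longleftrightarrow>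
     (\<exists>c. c \<noteq> 0 \<and> ((\<lambda>z. \<phi> z / z) \<longlongrightarrow> c) at_infinity)"

end

theory Submission
  imports Defs
begin

text \<open>
  Let \<open>h\<close> be the inverse of \<open>\<Psi>\<close>. In the coordinate \<open>u = \<Psi> z\<close>, far to the right, the hypothesis
  reads \<open>f (h u) = exp u + O(1 / h u) = exp (u + l u)\<close> with \<open>l\<close> holomorphic and
  \<open>\<bar>l u\<bar> = O(exp (- Re u) / \<bar>h u\<bar>)\<close>. Multiplying \<open>l\<close> by a cutoff in \<open>Re u\<close> gives a differentiable
  map \<open>k\<close> with small derivative that vanishes for \<open>Re u \<le> a\<close>, so \<open>u \<mapsto> u + k u\<close> is a quasiconformal
  diffeomorphism of the plane; let \<open>\<Phi>\<close> be its inverse. The map \<open>\<phi> = h \<circ> \<Phi> \<circ> \<Psi>\<close>, extended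
  by the identity outside \<open>T\<close>, satisfies \<open>g = f \<circ> \<phi>\<close> wherever \<open>k = l\<close>, so one map serves all large \<open>R\<close>.
  The displacement is bounded because \<open>\<bar>h'\<bar> = O(\<bar>h - p\<bar>)\<close> for a value \<open>p\<close> that \<open>h\<close> omits on the right
  half-plane.
\<close>

section \<open>Quasiconformality of differentiable plane maps\<close>

lemma lipschitz_imp_abs_continuous_on_interval:
  assumes "L-lipschitz_on {a..b} f"
  shows "abs_continuous_on_interval a b f"
  unfolding abs_continuous_on_interval_def
proof (intro allI impI)
  fix \<epsilon> :: real assume "\<epsilon> > 0"
  have L: "L \<ge> 0" using assms by (rule lipschitz_on_nonneg)
  show "\<exists>\<delta>>0. \<forall>\<D> S. \<D> division_of S \<longrightarrow> S \<subseteq> {a..b} \<longrightarrow>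
        (\<Sum>K\<in>\<D>. Sup K - Inf K) < \<delta> \<longrightarrow>
        (\<Sum>K\<in>\<D>. cmod (f (Sup K) - f (Inf K))) < \<epsilon>"
  proof (intro exI[of _ "\<epsilon> / (L + 1)"] conjI allI impI)
    show "\<epsilon> / (L + 1) > 0" using L \<open>\<epsilon> > 0\<close> by simp
    fix \<D> S assume D: "\<D> division_of S" "S \<subseteq> {a..b}" "(\<Sum>K\<in>\<D>. Sup K - Inf K) < \<epsilon> / (L + 1)"
    have K: "Inf K \<le> Sup K \<and> cmod (f (Sup K) - f (Inf K)) \<le> L * (Sup K - Inf K)" if "K \<in> \<D>" for K
    proof -
      from division_ofD[OF D(1)] that D(2) obtain c d where cd: "K = {c..d}" "K \<noteq> {}" "K \<subseteq> {a..b}"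
        by (metis box_real(2) subset_trans)
      then have "c \<le> d" by simp
      then have *: "Inf K = c" "Sup K = d" "c \<in> {a..b}" "d \<in> {a..b}" using cd by auto
      show ?thesis using lipschitz_onD[OF assms *(4,3)] * \<open>c \<le> d\<close> by (simp add: dist_norm)
    qed
    have nonneg: "(\<Sum>K\<in>\<D>. Sup K - Inf K) \<ge> 0" using K by (intro sum_nonneg) auto
    have "(\<Sum>K\<in>\<D>. cmod (f (Sup K) - f (Inf K))) \<le> (\<Sum>K\<in>\<D>. L * (Sup K - Inf K))"
      using K by (intro sum_mono) auto
    also have "\<dots> = L * (\<Sum>K\<in>\<D>. Sup K - Inf K)" by (simp add: sum_distrib_left)
    also have "\<dots> \<le> (L + 1) * (\<Sum>K\<in>\<D>. Sup K - Inf K)"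
      using nonneg by (simp add: distrib_right)
    also have "\<dots> < \<epsilon>" using D(3) L by (simp add: field_simps)
    finally show "(\<Sum>K\<in>\<D>. cmod (f (Sup K) - f (Inf K))) < \<epsilon>" .
  qed
qed

text \<open>Every real-linear map of the plane has the form
  \<open>v \<mapsto> a * v + b * cnj v\<close>. If the map is a derivative, \<open>a\<close> and
  \<open>b\<close> are the derivatives with respect to \<open>z\<close> and to the conjugate of
  \<open>z\<close>. The derivatives of \<open>k\<close>, \<open>\<Phi>\<close> and
  \<open>transplant \<Phi>\<close> are given in this form below.\<close>

lemma norm_linear_cnj_le:
  "cmod (a * v + b * cnj v) \<le> (cmod a + cmod b) * cmod v"
  by (metis complex_mod_cnj distrib_right norm_mult norm_triangle_ineq)

lemma onorm_linear_cnj_le: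
  "onorm (\<lambda>v. a * v + b * cnj v) \<le> cmod a + cmod b"
  by (rule onorm_bound) (use norm_linear_cnj_le in auto)

text \<open>The dilatation bound makes \<open>B\<close> at most as large as \<open>A\<close>, so a
  bound for \<open>A\<close> on a closed rectangle makes \<open>\<phi>\<close> Lipschitz there,
  hence absolutely continuous on every horizontal and vertical segment.\<close>

lemma quasiconformal_if_differentiable:
  fixes \<phi> A B :: "complex \<Rightarrow> complex"
  assumes hom: "homeomorphism UNIV UNIV \<phi> \<psi>"
    and der: "\<And>z. (\<phi> has_derivative (\<lambda>v. A z * v + B z * cnj v)) (at z)"
    and \<kappa>: "0 \<le> \<kappa>" "\<kappa> < 1" "\<And>z. cmod (B z) \<le> \<kappa> * cmod (A z)"
    and bdd: "\<And>K. compact K \<Longrightarrow> \<exists>M. \<forall>z\<in>K. cmod (A z) \<le> M"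
  shows "quasiconformal UNIV UNIV \<phi>"
  unfolding quasiconformal_def
proof (intro conjI)
  show "\<exists>\<psi>. homeomorphism UNIV UNIV \<phi> \<psi>" using hom by blast
  show "acl_on UNIV \<phi>"
    unfolding acl_on_def
  proof (intro allI impI)
    fix a b :: complex
    obtain M where M: "\<And>z. z \<in> cbox a b \<Longrightarrow> cmod (A z) \<le> M"
      using bdd[OF compact_cbox] by blast
    \<comment> \<open>The absolute value keeps \<open>L\<close> nonnegative when the rectangle is
      empty and \<open>M\<close> is arbitrary.\<close>
    define L where "L = 2 * \<bar>M\<bar>"
    have "L-lipschitz_on (cbox a b) \<phi>"
    proof (rule lipschitz_onI)
      fix x y assume xy: "x \<in> cbox a b" "y \<in> cbox a b"
      have "norm (\<phi> x - \<phi> y) \<le> L * norm (x - y)"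
      proof (rule differentiable_bound[of "cbox a b"])
        show "convex (cbox a b)" by (rule convex_box)
        fix z assume z: "z \<in> cbox a b"
        show "(\<phi> has_derivative (\<lambda>v. A z * v + B z * cnj v)) (at z within cbox a b)"
          using der by (rule has_derivative_at_withinI)
        have "cmod (B z) \<le> 1 * cmod (A z)"
          using \<kappa>(2) order_trans[OF \<kappa>(3) mult_right_mono[of \<kappa> 1]] by simp
        then have "cmod (A z) + cmod (B z) \<le> L" using M[OF z] unfolding L_def by linarith
        then show "onorm (\<lambda>v. A z * v + B z * cnj v) \<le> L"
          using onorm_linear_cnj_le order_trans by blast
      qed (use xy in auto)
      then show "dist (\<phi> x) (\<phi> y) \<le> L * dist x y" by (simp add: dist_norm)
    qed (simp add: L_def)
    note lip = lipschitz_onD[OF this] lipschitz_on_nonneg[OF this]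
    have "abs_continuous_on_interval (Re a) (Re b) (\<lambda>x. \<phi> (Complex x y))"
      if "y \<in> {Im a..Im b}" for y
    proof (rule lipschitz_imp_abs_continuous_on_interval[OF lipschitz_onI])
      fix s t assume "s \<in> {Re a..Re b}" "t \<in> {Re a..Re b}"
      then have "dist (\<phi> (Complex s y)) (\<phi> (Complex t y)) \<le> L * dist (Complex s y) (Complex t y)"
        using that by (intro lip) (auto simp: in_cbox_complex_iff)
      then show "dist (\<phi> (Complex s y)) (\<phi> (Complex t y)) \<le> L * dist s t"
        by (simp add: dist_norm complex_diff cmod_def)
    qed (rule lip)
    moreover have "abs_continuous_on_interval (Im a) (Im b) (\<lambda>y. \<phi> (Complex x y))"
      if "x \<in> {Re a..Re b}" for x
    proof (rule lipschitz_imp_abs_continuous_on_interval[OF lipschitz_onI])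
      fix s t assume "s \<in> {Im a..Im b}" "t \<in> {Im a..Im b}"
      then have "dist (\<phi> (Complex x s)) (\<phi> (Complex x t)) \<le> L * dist (Complex x s) (Complex x t)"
        using that by (intro lip) (auto simp: in_cbox_complex_iff)
      then show "dist (\<phi> (Complex x s)) (\<phi> (Complex x t)) \<le> L * dist s t"
        by (simp add: dist_norm complex_diff cmod_def)
    qed (rule lip)
    ultimately show "(AE y in lborel. y \<in> {Im a..Im b} \<longrightarrow>
           abs_continuous_on_interval (Re a) (Re b) (\<lambda>x. \<phi> (Complex x y))) \<and>
        (AE x in lborel. x \<in> {Re a..Re b} \<longrightarrow>
           abs_continuous_on_interval (Im a) (Im b) (\<lambda>y. \<phi> (Complex x y)))"
      by simp
  qed
  have "\<exists>p q. ((\<lambda>t. \<phi> (z + of_real t)) has_vector_derivative p) (at 0) \<and>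
              ((\<lambda>t. \<phi> (z + \<i> * of_real t)) has_vector_derivative q) (at 0) \<and>
              cmod ((p + \<i> * q) / 2) \<le> \<kappa> * cmod ((p - \<i> * q) / 2)" for z
  proof (intro exI conjI)
    have *: "((\<lambda>t. \<phi> (z + w * of_real t)) has_vector_derivative (A z * w + B z * cnj w)) (at 0)" for w
    proof -
      have "((\<lambda>t. z + w * of_real t) has_derivative (\<lambda>t. w * of_real t)) (at (0::real))"
        by (auto intro!: derivative_eq_intros)
      from has_derivative_compose[OF this, of \<phi> "\<lambda>v. A z * v + B z * cnj v"] der[of z]
      have "((\<lambda>t. \<phi> (z + w * of_real t)) has_derivative
              (\<lambda>t. A z * (w * of_real t) + B z * cnj (w * of_real t))) (at 0)" by simp
      then show ?thesis
        unfolding has_vector_derivative_def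
        by (simp add: scaleR_conv_of_real algebra_simps)
    qed
    show "((\<lambda>t. \<phi> (z + of_real t)) has_vector_derivative (A z + B z)) (at 0)"
      using *[of 1] by simp
    show "((\<lambda>t. \<phi> (z + \<i> * of_real t)) has_vector_derivative (\<i> * A z - \<i> * B z)) (at 0)"
      using *[of \<i>] by (simp add: algebra_simps)
    \<comment> \<open>With \<open>p = A z + B z\<close> and \<open>q = \<i> * (A z - B z)\<close>,
      the two combinations in the definition give back \<open>B z\<close> and
      \<open>A z\<close>.\<close>
    have eqs: "(A z + B z + \<i> * (\<i> * A z - \<i> * B z)) / 2 = B z"
         "(A z + B z - \<i> * (\<i> * A z - \<i> * B z)) / 2 = A z"
      by (simp_all add: algebra_simps flip: mult.assoc)
    show "cmod ((A z + B z + \<i> * (\<i> * A z - \<i> * B z)) / 2)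
          \<le> \<kappa> * cmod ((A z + B z - \<i> * (\<i> * A z - \<i> * B z)) / 2)"
      unfolding eqs by (rule \<kappa>(3))
  qed
  then show "\<exists>k. 0 \<le> k \<and> k < 1 \<and>
        (AE z in lborel. z \<in> UNIV \<longrightarrow>
           (\<exists>p q. ((\<lambda>t. \<phi> (z + of_real t)) has_vector_derivative p) (at 0) \<and>
                  ((\<lambda>t. \<phi> (z + \<i> * of_real t)) has_vector_derivative q) (at 0) \<and>
                  cmod ((p + \<i> * q) / 2) \<le> k * cmod ((p - \<i> * q) / 2)))"
    using \<kappa> by (intro exI[of _ \<kappa>]) auto
qed

section \<open>Inverting a small perturbation of the identity\<close>

text \<open>The bounds on \<open>P\<close> and \<open>Q\<close> make \<open>k\<close> Lipschitz with
  constant \<open>1/2\<close>. So \<open>u \<mapsto> w - k u\<close> is a contraction, and its fixed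
  point is the unique preimage of \<open>w\<close> under \<open>u \<mapsto> u + k u\<close>.\<close>

lemma perturbed_identity_inverse:
  fixes k P Q :: "complex \<Rightarrow> complex"
  assumes der: "\<And>u. (k has_derivative (\<lambda>v. P u * v + Q u * cnj v)) (at u)"
    and PQ: "\<And>u. cmod (P u) \<le> 1/4" "\<And>u. cmod (Q u) \<le> 1/4"
  obtains \<Phi> A B where
    "homeomorphism UNIV UNIV \<Phi> (\<lambda>u. u + k u)"
    "\<And>w. (\<Phi> has_derivative (\<lambda>v. A w * v + B w * cnj v)) (at w)"
    "\<And>w. cmod (A w) \<le> 2" "\<And>w. cmod (B w) \<le> 1/2 * cmod (A w)"
proof -
  have lip: "norm (k x - k y) \<le> 1/2 * norm (x - y)" for x y
  proof (rule differentiable_bound[of UNIV])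
    fix u show "onorm (\<lambda>v. P u * v + Q u * cnj v) \<le> 1/2"
      using onorm_linear_cnj_le[of "P u" "Q u"] PQ[of u] by linarith
  qed (use der in auto)
  have ex1: "\<exists>!u. u + k u = w" for w
  proof -
    have "\<exists>!u. w - k u = u"
      by (rule banach_fix_type[of "1/2"]) (use lip in \<open>auto simp: dist_norm norm_minus_commute\<close>)
    moreover have "w - k u = u \<longleftrightarrow> u + k u = w" for u by (auto simp: algebra_simps)
    ultimately show ?thesis by simp
  qed
  define \<Phi> where "\<Phi> w = (THE u. u + k u = w)" for w
  have \<Phi>: "\<Phi> w + k (\<Phi> w) = w" for w
    unfolding \<Phi>_def by (rule theI'[OF ex1])
  have \<Phi>': "\<Phi> (u + k u) = u" for u
    using ex1 \<Phi> by blast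
  have lip\<Phi>: "norm (\<Phi> x - \<Phi> y) \<le> 2 * norm (x - y)" for x y
  proof -
    have "\<Phi> x - \<Phi> y = (x - y) - (k (\<Phi> x) - k (\<Phi> y))"
      using \<Phi>[of x] \<Phi>[of y] by (simp add: algebra_simps)
    then have "norm (\<Phi> x - \<Phi> y) \<le> norm (x - y) + norm (k (\<Phi> x) - k (\<Phi> y))"
      by (metis norm_triangle_ineq4)
    with lip[of "\<Phi> x" "\<Phi> y"] show ?thesis by simp
  qed
  have "2-lipschitz_on UNIV \<Phi>"
    by (rule lipschitz_onI) (use lip\<Phi> in \<open>auto simp: dist_norm\<close>)
  then have cont\<Phi>: "continuous_on UNIV \<Phi>" by (rule lipschitz_on_continuous_on)
  have contk: "continuous_on UNIV k"
    using der has_derivative_continuous by (blast intro: continuous_at_imp_continuous_on)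
  define \<alpha> where "\<alpha> w = 1 + P (\<Phi> w)" for w
  define \<beta> where "\<beta> w = Q (\<Phi> w)" for w
  \<comment> \<open>The Jacobian determinant of \<open>u \<mapsto> u + k u\<close> at
    \<open>\<Phi> w\<close>, the denominator in the inverse of
    \<open>v \<mapsto> \<alpha> w * v + \<beta> w * cnj v\<close>.\<close>
  define d where "d w = \<alpha> w * cnj (\<alpha> w) - \<beta> w * cnj (\<beta> w)" for w
  have \<alpha>: "cmod (\<alpha> w) \<ge> 3/4" for w
    using norm_diff_ineq[of 1 "P (\<Phi> w)"] PQ[of "\<Phi> w"] unfolding \<alpha>_def by (simp add: field_simps)
  have \<beta>: "cmod (\<beta> w) \<le> 1/2 * cmod (\<alpha> w)" for w
    using \<alpha>[of w] PQ[of "\<Phi> w"] unfolding \<beta>_def by (simp add: field_simps)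
  have d: "cmod (d w) \<ge> 3/4 * (cmod (\<alpha> w))\<^sup>2" for w
  proof -
    have "cmod (d w) \<ge> cmod (\<alpha> w * cnj (\<alpha> w)) - cmod (\<beta> w * cnj (\<beta> w))"
      unfolding d_def by (rule norm_triangle_ineq2)
    moreover have "(cmod (\<beta> w))\<^sup>2 \<le> (1/2 * cmod (\<alpha> w))\<^sup>2"
      using \<beta> by (intro power_mono) auto
    ultimately show ?thesis by (simp add: norm_mult power2_eq_square)
  qed
  have d0: "d w \<noteq> 0" for w
  proof -
    have "(cmod (\<alpha> w))\<^sup>2 > 0" using \<alpha>[of w] by auto
    then show ?thesis using d[of w] by auto
  qed
  show ?thesis
  proof (rule that[of \<Phi> "\<lambda>w. cnj (\<alpha> w) / d w" "\<lambda>w. - \<beta> w / d w"])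
    show "homeomorphism UNIV UNIV \<Phi> (\<lambda>u. u + k u)"
      unfolding homeomorphism_def using \<Phi> \<Phi>' cont\<Phi> contk
      by (auto intro!: continuous_intros simp: image_iff) metis+
    fix w
    show "(\<Phi> has_derivative (\<lambda>v. cnj (\<alpha> w) / d w * v + - \<beta> w / d w * cnj v)) (at w)"
    proof (rule has_derivative_inverse_basic[where f = "\<lambda>u. u + k u" and T = UNIV])
      show "((\<lambda>u. u + k u) has_derivative (\<lambda>v. \<alpha> w * v + \<beta> w * cnj v)) (at (\<Phi> w))"
        unfolding \<alpha>_def \<beta>_def
        by (rule derivative_eq_intros der refl)+ (simp add: algebra_simps)
      show "bounded_linear (\<lambda>v. cnj (\<alpha> w) / d w * v + - \<beta> w / d w * cnj v)"
        by (intro bounded_linear_add bounded_linear_mult_right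
              bounded_linear_compose[OF bounded_linear_mult_right bounded_linear_cnj])
      show "(\<lambda>v. cnj (\<alpha> w) / d w * v + - \<beta> w / d w * cnj v) \<circ> (\<lambda>v. \<alpha> w * v + \<beta> w * cnj v) = id"
      proof
        fix v
        have "cnj (\<alpha> w) * (\<alpha> w * v + \<beta> w * cnj v) - \<beta> w * cnj (\<alpha> w * v + \<beta> w * cnj v) = d w * v"
          by (simp add: d_def algebra_simps)
        then have "(cnj (\<alpha> w) * (\<alpha> w * v + \<beta> w * cnj v) - \<beta> w * cnj (\<alpha> w * v + \<beta> w * cnj v)) / d w = v"
          using d0[of w] by simp
        then show "((\<lambda>v. cnj (\<alpha> w) / d w * v + - \<beta> w / d w * cnj v) \<circ> (\<lambda>v. \<alpha> w * v + \<beta> w * cnj v)) v = id v"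
          by (simp add: diff_divide_distrib)
      qed
      show "continuous (at w) \<Phi>" using cont\<Phi> by (simp add: continuous_on_eq_continuous_at)
    qed (use \<Phi> in auto)
    show "cmod (cnj (\<alpha> w) / d w) \<le> 2"
    proof -
      have "cmod (\<alpha> w) * (3/4) \<le> cmod (\<alpha> w) * cmod (\<alpha> w)" using \<alpha>[of w] by (intro mult_left_mono) auto
      then have "cmod (\<alpha> w) \<le> 2 * cmod (d w)" using d[of w] norm_ge_zero[of "d w"] unfolding power2_eq_square by linarith
      then show ?thesis using d0[of w] by (simp add: norm_divide divide_le_eq)
    qed
    \<comment> \<open>Both coefficients of the inverse have denominator \<open>d w\<close>, so their
      ratio has the same modulus as \<open>\<beta> w / \<alpha> w\<close>.\<close>
    show "cmod (- \<beta> w / d w) \<le> 1 / 2 * cmod (cnj (\<alpha> w) / d w)"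
      using divide_right_mono[OF \<beta>[of w] norm_ge_zero[of "d w"]] by (simp add: norm_divide)
  qed
qed

section \<open>Increments of univalent functions that omit a value\<close>

lemma norm_exp_minus_1_le: "cmod (exp z - 1) \<le> cmod z * exp (cmod z)"
  using Taylor_exp_field[of z 0] by (simp add: mult.commute)

text \<open>Since \<open>exp \<circ> L\<close> is injective, the image of \<open>L\<close> contains no two points that differ by
  \<open>2\<pi>\<i>\<close>, hence no disc of radius greater than \<open>\<pi>\<close>; Bloch's theorem does the rest.\<close>

lemma norm_deriv_le_if_inj_exp:
  assumes "L holomorphic_on ball c r" "r > 0" "inj_on (\<lambda>z. exp (L z)) (ball c r)"
  shows "cmod (deriv L c) \<le> 12 * pi / r"
proof (rule ccontr)
  assume "\<not> ?thesis"
  \<comment> \<open>The right-hand side is the radius of the disc that Bloch's theorem finds in the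
    image.\<close>
  then have *: "pi < r * cmod (deriv L c) / 12" using \<open>r > 0\<close> by (simp add: field_simps)
  obtain b where b: "ball b (r * cmod (deriv L c) / 12) \<subseteq> L ` ball c r"
    using Bloch[OF assms(1,2) order_refl] by blast
  have "b + \<i> * of_real pi \<in> L ` ball c r" "b - \<i> * of_real pi \<in> L ` ball c r"
    using b * by (auto intro!: subsetD[OF b] simp: dist_norm norm_mult)
  then obtain x y where xy: "x \<in> ball c r" "y \<in> ball c r"
      "L x = b + \<i> * of_real pi" "L y = b - \<i> * of_real pi" by (auto elim!: imageE)
  then have "exp (L x) = exp (L y)" by (simp add: exp_add exp_diff)
  then have "x = y" using inj_onD[OF assms(3) _ xy(1,2)] by simp
  then show False using xy by simp
qed

text \<open>As \<open>h - p\<close> has no zero on the disc, it has a holomorphic logarithm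
  \<open>L\<close>, and \<open>exp \<circ> L\<close> inherits injectivity from \<open>h\<close>. So
  \<open>deriv L\<close> has a universal bound on the half-size disc. Integrating and exponentiating
  bounds the increment of \<open>h\<close> relative to \<open>h u - p\<close>.\<close>

lemma univalent_increment_le:
  assumes hol: "h holomorphic_on ball u 1" and inj: "inj_on h (ball u 1)"
    and p: "p \<notin> h ` ball u 1" and v: "cmod (v - u) \<le> 1/2"
  shows "cmod (h v - h u) \<le> 24 * pi * exp (12 * pi) * cmod (h u - p) * cmod (v - u)"
proof -
  have hol': "(\<lambda>z. h z - p) holomorphic_on ball u 1" using hol by (intro holomorphic_intros)
  have nz: "h x - p \<noteq> 0" if "x \<in> ball u 1" for x
    using p that by auto
  have "u \<in> ball u 1" by simp
  then obtain L where L: "L holomorphic_on ball u 1" "\<And>x. x \<in> ball u 1 \<Longrightarrow> exp (L x) = h x - p"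
    using holomorphic_logarithm_exists[OF convex_ball open_ball hol' nz] by blast
  have "cmod (deriv L x) \<le> 24 * pi" if "x \<in> cball u (1/2)" for x
  proof -
    have sub: "ball x (1/2) \<subseteq> ball u 1"
    proof
      fix y assume "y \<in> ball x (1/2)"
      then show "y \<in> ball u 1" using that dist_triangle[of u y x] by simp
    qed
    have "cmod (deriv L x) \<le> 12 * pi / (1/2)"
    proof (rule norm_deriv_le_if_inj_exp)
      show "L holomorphic_on ball x (1/2)" using L(1) sub by (rule holomorphic_on_subset)
      show "inj_on (\<lambda>z. exp (L z)) (ball x (1 / 2))"
        using inj L(2) sub by (auto simp: inj_on_def subset_iff)
    qed simp
    then show ?thesis by simp
  qed
  moreover have "(L has_field_derivative deriv L x) (at x within cball u (1/2))" if "x \<in> cball u (1/2)" for x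
    using holomorphic_derivI[OF L(1) open_ball, of x] that by (auto intro: has_field_derivative_at_within)
  ultimately have "cmod (L v - L u) \<le> 24 * pi * cmod (v - u)"
    using v by (intro field_differentiable_bound[of "cball u (1/2)"]) (auto simp: dist_norm norm_minus_commute)
  \<comment> \<open>This second, uniform bound turns the exponential factor of
    \<open>norm_exp_minus_1_le\<close> into the constant \<open>exp (12 * pi)\<close>.\<close>
  moreover have "24 * pi * cmod (v - u) \<le> 24 * pi * (1/2)"
    using v by (intro mult_left_mono) auto
  ultimately have "cmod (L v - L u) \<le> 24 * pi * cmod (v - u)" "cmod (L v - L u) \<le> 12 * pi"
    by linarith+
  then have "cmod (exp (L v - L u) - 1) \<le> (24 * pi * cmod (v - u)) * exp (12 * pi)"
    by (intro order_trans[OF norm_exp_minus_1_le] mult_mono) auto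
  moreover have "h v - h u = (h u - p) * (exp (L v - L u) - 1)"
  proof -
    have "v \<in> ball u 1" using v by (simp add: dist_norm norm_minus_commute)
    then have "exp (L v - L u) = (h v - p) / (h u - p)"
      using L(2)[of u] L(2)[of v] by (simp add: exp_diff)
    then show ?thesis using nz[of u] by (simp add: field_simps)
  qed
  ultimately have "cmod (h v - h u) \<le> cmod (h u - p) * ((24 * pi * cmod (v - u)) * exp (12 * pi))"
    by (simp only: norm_mult mult_left_mono norm_ge_zero)
  then show ?thesis by (simp only: mult_ac)
qed

section \<open>Transplanting plane maps through a conformal chart\<close>

text \<open>Closedness of the image of the half-plane, in the whole plane and not only in
  \<open>T\<close>, is what allows an extension by the identity: the complement of that image is
  open and together with \<open>T\<close> covers the plane.\<close>

locale half_plane_chart =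
  fixes T H :: "complex set" and \<Psi> h :: "complex \<Rightarrow> complex" and a :: real
  assumes open_T: "open T" and open_H: "open H"
    and \<Psi>: "\<Psi> holomorphic_on T" "\<And>z. z \<in> T \<Longrightarrow> \<Psi> z \<in> H" "\<And>z. z \<in> T \<Longrightarrow> h (\<Psi> z) = z"
    and h: "h holomorphic_on H" "\<And>w. w \<in> H \<Longrightarrow> h w \<in> T" "\<And>w. w \<in> H \<Longrightarrow> \<Psi> (h w) = w"
    and half_plane: "{w. Re w \<ge> a} \<subseteq> H"
    and closed: "closed (h ` {w. Re w \<ge> a})"
begin

definition transplant :: "(complex \<Rightarrow> complex) \<Rightarrow> complex \<Rightarrow> complex" where
  "transplant \<Phi> z = (if z \<in> T then h (\<Phi> (\<Psi> z)) else z)"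

text \<open>The second clause keeps the values on the half-plane inside it, so that \<open>h\<close>
  is only evaluated on \<open>H\<close> when \<open>\<Phi>\<close> is transplanted.\<close>

abbreviation supported :: "(complex \<Rightarrow> complex) \<Rightarrow> bool" where
  "supported \<Phi> \<equiv> (\<forall>w. Re w \<le> a \<longrightarrow> \<Phi> w = w) \<and> (\<forall>w. Re w > a \<longrightarrow> Re (\<Phi> w) > a)"

lemma supported_in_H: "supported \<Phi> \<Longrightarrow> w \<in> H \<Longrightarrow> \<Phi> w \<in> H"
  using subsetD[OF half_plane, of "\<Phi> w"] by (cases "Re w \<le> a") (auto simp: not_le less_imp_le)

lemma transplant_eq_self:
  assumes "supported \<Phi>" "z \<notin> h ` {w. Re w \<ge> a}"
  shows "transplant \<Phi> z = z"
proof (cases "z \<in> T")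
  case True
  then have "Re (\<Psi> z) < a" using assms(2) \<Psi>(3)[of z] by (metis (mono_tags) image_eqI mem_Collect_eq not_less)
  then show ?thesis using assms(1) \<Psi>(3) by (simp add: transplant_def)
qed (simp add: transplant_def)

lemma h_half_plane_subset: "h ` {w. Re w \<ge> a} \<subseteq> T"
  using h(2) half_plane by blast

lemma transplant_inverse:
  assumes "supported \<Phi>" "\<And>w. \<Phi>' (\<Phi> w) = w"
  shows "transplant \<Phi>' (transplant \<Phi> z) = z"
  using assms supported_in_H[OF assms(1)] h \<Psi> by (simp add: transplant_def)

text \<open>Gluing over two open sets that cover the plane: on \<open>T\<close> the map is a
  composition of continuous maps, and off the image of the half-plane it is the identity.\<close>

lemma continuous_transplant:
  assumes "supported \<Phi>" "continuous_on UNIV \<Phi>"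
  shows "continuous_on UNIV (transplant \<Phi>)"
proof -
  have "continuous_on (T \<union> - h ` {w. Re w \<ge> a}) (transplant \<Phi>)"
  proof (rule continuous_on_open_Un)
    have "continuous_on T (\<lambda>z. h (\<Phi> (\<Psi> z)))"
      by (rule continuous_on_compose2[OF holomorphic_on_imp_continuous_on[OF h(1)]
            continuous_on_compose2[OF assms(2) holomorphic_on_imp_continuous_on[OF \<Psi>(1)]]])
         (use supported_in_H[OF assms(1)] \<Psi>(2) in auto)
    then show "continuous_on T (transplant \<Phi>)"
      by (rule continuous_on_eq) (simp add: transplant_def)
    show "continuous_on (- h ` {w. Re w \<ge> a}) (transplant \<Phi>)"
      by (rule continuous_on_eq[OF continuous_on_id]) (simp add: transplant_eq_self[OF assms(1)])
  qed (use open_T closed in auto)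
  moreover have "T \<union> - h ` {w. Re w \<ge> a} = UNIV" using h_half_plane_subset by blast
  ultimately show ?thesis by simp
qed

text \<open>Composing with holomorphic maps on either side multiplies \<open>A\<close> and
  \<open>B\<close> by factors of equal modulus, so the dilatation bound is preserved. Off the image
  of the half-plane the map is the identity.\<close>

lemma quasiconformal_transplant:
  assumes hom: "homeomorphism UNIV UNIV \<Phi> \<Phi>'"
    and supp: "supported \<Phi>" "supported \<Phi>'"
    and der: "\<And>w. (\<Phi> has_derivative (\<lambda>v. A w * v + B w * cnj v)) (at w)"
    and A: "\<And>w. cmod (A w) \<le> M"
    and \<kappa>: "0 \<le> \<kappa>" "\<kappa> < 1" "\<And>w. cmod (B w) \<le> \<kappa> * cmod (A w)"
  shows "quasiconformal UNIV UNIV (transplant \<Phi>)"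
proof -
  define E where "E = h ` {w. Re w \<ge> a}"
  \<comment> \<open>Both coefficients come from the chain rule; the inner derivative enters
    \<open>B'\<close> conjugated.\<close>
  define A' where "A' z = (if z \<in> E then deriv h (\<Phi> (\<Psi> z)) * A (\<Psi> z) * deriv \<Psi> z else 1)" for z
  define B' where "B' z = (if z \<in> E then deriv h (\<Phi> (\<Psi> z)) * B (\<Psi> z) * cnj (deriv \<Psi> z) else 0)" for z
  have ET: "E \<subseteq> T" unfolding E_def by (rule h_half_plane_subset)
  have cont: "continuous_on UNIV \<Phi>" "continuous_on UNIV \<Phi>'" and inv: "\<And>w. \<Phi>' (\<Phi> w) = w" "\<And>w. \<Phi> (\<Phi>' w) = w"
    using hom by (auto simp: homeomorphism_def)
  show ?thesis
  proof (rule quasiconformal_if_differentiable[OF _ _ \<kappa>(1,2)])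
    show "homeomorphism UNIV UNIV (transplant \<Phi>) (transplant \<Phi>')"
      by (rule homeomorphismI)
         (simp_all add: continuous_transplant supp cont transplant_inverse inv)
    fix z
    show "(transplant \<Phi> has_derivative (\<lambda>v. A' z * v + B' z * cnj v)) (at z)"
    proof (cases "z \<in> E")
      case True
      then have zT: "z \<in> T" using ET by blast
      have "(\<Psi> has_derivative (\<lambda>v. deriv \<Psi> z * v)) (at z)"
        using holomorphic_derivI[OF \<Psi>(1) open_T zT] by (simp add: has_field_derivative_def)
      from has_derivative_compose[OF has_derivative_compose[OF this der], of h "(*) (deriv h (\<Phi> (\<Psi> z)))"]
      have "((\<lambda>z. h (\<Phi> (\<Psi> z))) has_derivative (\<lambda>v. deriv h (\<Phi> (\<Psi> z)) *
              (A (\<Psi> z) * (deriv \<Psi> z * v) + B (\<Psi> z) * cnj (deriv \<Psi> z * v)))) (at z)"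
        using holomorphic_derivI[OF h(1) open_H supported_in_H[OF supp(1) \<Psi>(2)[OF zT]]]
        by (simp add: has_field_derivative_def)
      then have "(transplant \<Phi> has_derivative (\<lambda>v. deriv h (\<Phi> (\<Psi> z)) *
              (A (\<Psi> z) * (deriv \<Psi> z * v) + B (\<Psi> z) * cnj (deriv \<Psi> z * v)))) (at z)"
        by (rule has_derivative_transform_within_open[OF _ open_T zT]) (simp add: transplant_def)
      then show ?thesis using True by (simp add: A'_def B'_def algebra_simps)
    next
      case False
      have "((\<lambda>z. z) has_derivative (\<lambda>v. v)) (at z)" by (rule has_derivative_ident)
      then have "(transplant \<Phi> has_derivative (\<lambda>v. v)) (at z)"
        by (rule has_derivative_transform_within_open[of _ _ _ _ "- E"])
           (use False closed in \<open>auto simp: transplant_eq_self[OF supp(1)] E_def\<close>)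
      then show ?thesis using False by (simp add: A'_def B'_def)
    qed
    have "cmod (deriv h (\<Phi> (\<Psi> z))) * cmod (B (\<Psi> z)) * cmod (deriv \<Psi> z)
            \<le> cmod (deriv h (\<Phi> (\<Psi> z))) * (\<kappa> * cmod (A (\<Psi> z))) * cmod (deriv \<Psi> z)"
      by (intro mult_left_mono mult_right_mono \<kappa>(3)) auto
    then show "cmod (B' z) \<le> \<kappa> * cmod (A' z)"
      using \<kappa>(1) by (simp add: A'_def B'_def norm_mult mult_ac)
  next
    fix K :: "complex set" assume "compact K"
    \<comment> \<open>Even if \<open>K\<close> meets the boundary of \<open>T\<close>, this set is a
      compact subset of \<open>T\<close>, so the derivatives of the chart are bounded on it.\<close>
    then have K: "compact (K \<inter> E)" using closed by (simp add: E_def compact_Int_closed)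
    have "continuous_on T (\<lambda>z. deriv h (\<Phi> (\<Psi> z)))"
      by (rule continuous_on_compose2[OF holomorphic_on_imp_continuous_on[OF holomorphic_deriv[OF h(1) open_H]]
            continuous_on_compose2[OF cont(1) holomorphic_on_imp_continuous_on[OF \<Psi>(1)]]])
         (use supported_in_H[OF supp(1)] \<Psi>(2) in auto)
    then have "continuous_on (K \<inter> E) (\<lambda>z. deriv h (\<Phi> (\<Psi> z)) * deriv \<Psi> z)"
      using holomorphic_on_imp_continuous_on[OF holomorphic_deriv[OF \<Psi>(1) open_T]] ET
      by (intro continuous_on_mult) (auto intro: continuous_on_subset)
    then have "bounded ((\<lambda>z. deriv h (\<Phi> (\<Psi> z)) * deriv \<Psi> z) ` (K \<inter> E))"
      using K by (intro compact_imp_bounded compact_continuous_image)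
    then obtain C where C: "\<And>z. z \<in> K \<inter> E \<Longrightarrow> cmod (deriv h (\<Phi> (\<Psi> z)) * deriv \<Psi> z) \<le> C"
      unfolding bounded_iff by blast
    have "cmod (A' z) \<le> max 1 (C * M)" if "z \<in> K" for z
    proof (cases "z \<in> E")
      case True
      have "cmod (A' z) = cmod (deriv h (\<Phi> (\<Psi> z)) * deriv \<Psi> z) * cmod (A (\<Psi> z))"
        using True by (simp add: A'_def norm_mult)
      also have "\<dots> \<le> C * M"
        using C[of z] True that A order_trans[OF norm_ge_zero C[of z]] by (intro mult_mono) auto
      finally show ?thesis by simp
    qed (simp add: A'_def)
    then show "\<exists>M. \<forall>z\<in>K. cmod (A' z) \<le> M" by blast
  qed
qed

end

section \<open>Cutting off a small holomorphic function\<close>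

text \<open>A piecewise quadratic cutoff suffices: \<open>r\<close> is the square of the positive
  part, differentiable with derivative \<open>2 * max 0 t\<close>, and second differences of its
  translates give \<open>\<rho>\<close>.\<close>

lemma C1_cutoff_exists:
  obtains \<rho> \<rho>' :: "real \<Rightarrow> real" where
    "\<And>t. (\<rho> has_real_derivative \<rho>' t) (at t)" "\<And>t. \<bar>\<rho> t\<bar> \<le> 1" "\<And>t. \<bar>\<rho>' t\<bar> \<le> 2"
    "\<And>t. t \<le> 0 \<Longrightarrow> \<rho> t = 0" "\<And>t. t \<ge> 1 \<Longrightarrow> \<rho> t = 1"
proof -
  define r :: "real \<Rightarrow> real" where "r t = t * max 0 t" for t
  define \<rho> where "\<rho> t = 2 * r t - 4 * r (t - 1/2) + 2 * r (t - 1)" for t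
  \<comment> \<open>the piecewise linear hat on \<open>{0..1}\<close> with peak \<open>2\<close>, so its integral \<open>\<rho>\<close> ends at \<open>1\<close>\<close>
  define \<rho>' :: "real \<Rightarrow> real" where "\<rho>' t = 4 * max 0 t - 8 * max 0 (t - 1/2) + 4 * max 0 (t - 1)" for t
  have r: "(r has_real_derivative 2 * max 0 t) (at t)" for t
  proof -
    consider "t < 0" | "t = 0" | "t > 0" by linarith
    then show ?thesis
    proof cases
      case 1
      have "((\<lambda>t. 0) has_real_derivative 2 * max 0 t) (at t)" using 1 by simp
      then show ?thesis
        by (rule has_field_derivative_transform_within_open[of _ _ _ "{..<0}"])
           (use 1 in \<open>auto simp: r_def\<close>)
    next
      case 2
      \<comment> \<open>Caratheodory's criterion: \<open>r t - r 0 = max 0 t * (t - 0)\<close>, and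
        \<open>max 0\<close> is continuous with value \<open>0\<close> at \<open>0\<close>.\<close>
      then show ?thesis unfolding CARAT_DERIV
        by (intro exI[of _ "max 0"]) (auto simp: r_def intro!: continuous_intros)
    next
      case 3
      have "((\<lambda>t. t * t) has_real_derivative 2 * max 0 t) (at t)"
        using 3 by (auto intro!: derivative_eq_intros)
      then show ?thesis
        by (rule has_field_derivative_transform_within_open[of _ _ _ "{0<..}"])
           (use 3 in \<open>auto simp: r_def\<close>)
    qed
  qed
  have \<rho>: "(\<rho> has_real_derivative \<rho>' t) (at t)" for t
  proof -
    have "((\<lambda>t. r (t - c)) has_real_derivative 2 * max 0 (t - c)) (at t)" for c
    proof -
      have "((\<lambda>t. t - c) has_real_derivative 1) (at t)" by (auto intro!: derivative_eq_intros)
      from DERIV_chain2[where f = r and g = "\<lambda>t. t - c" and x = t and s = UNIV, OF r this]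
      show ?thesis by simp
    qed
    note this[of "1/2"] this[of 1] r[of t]
    from DERIV_add[OF DERIV_diff[OF DERIV_cmult[OF this(3), of 2] DERIV_cmult[OF this(1), of 4]]
        DERIV_cmult[OF this(2), of 2]]
    show ?thesis unfolding \<rho>_def[abs_def] \<rho>'_def by simp
  qed
  have zero: "\<rho> t = 0" if "t \<le> 0" for t
    using that by (simp add: \<rho>_def r_def max_def)
  have one: "\<rho> t = 1" if "t \<ge> 1" for t
    using that by (simp add: \<rho>_def r_def max_def algebra_simps)
  have mono: "\<rho> s \<le> \<rho> t" if "s \<le> t" for s t
    using that
    by (rule DERIV_nonneg_imp_nondecreasing) (use \<rho> in \<open>force simp: \<rho>'_def max_def\<close>)
  show ?thesis
  proof
    show "\<bar>\<rho> t\<bar> \<le> 1" for t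
      using mono[of "min t 0" t] mono[of t "max t 1"] zero[of "min t 0"] one[of "max t 1"] by simp
    show "\<bar>\<rho>' t\<bar> \<le> 2" for t by (simp add: \<rho>'_def max_def)
  qed (use \<rho> zero one in auto)
qed

text \<open>Here \<open>k\<close> is \<open>l\<close> times a cutoff in \<open>Re u\<close>.
  Cauchy's inequality on discs of radius \<open>1/3\<close> bounds \<open>deriv l\<close> by
  \<open>1/8\<close>, and the terms from the derivative of the cutoff are at most
  \<open>1/16\<close>, so \<open>P\<close> and \<open>Q\<close> stay below
  \<open>1/4\<close>.\<close>

lemma holomorphic_cutoff:
  assumes hol: "l holomorphic_on {u. Re u > a - 1}"
    and small: "\<And>u. Re u > a - 1 \<Longrightarrow> cmod (l u) \<le> 1/24"
  obtains k P Q where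
    "\<And>u. (k has_derivative (\<lambda>v. P u * v + Q u * cnj v)) (at u)"
    "\<And>u. cmod (P u) \<le> 1/4" "\<And>u. cmod (Q u) \<le> 1/4"
    "\<And>u. Re u \<le> a \<Longrightarrow> k u = 0" "\<And>u. Re u \<ge> a + 1 \<Longrightarrow> k u = l u"
    "\<And>u. Re u > a \<Longrightarrow> cmod (k u) \<le> cmod (l u)"
proof -
  obtain \<rho> \<rho>' :: "real \<Rightarrow> real" where \<rho>:
    "\<And>t. (\<rho> has_real_derivative \<rho>' t) (at t)" "\<And>t. \<bar>\<rho> t\<bar> \<le> 1" "\<And>t. \<bar>\<rho>' t\<bar> \<le> 2"
    "\<And>t. t \<le> 0 \<Longrightarrow> \<rho> t = 0" "\<And>t. t \<ge> 1 \<Longrightarrow> \<rho> t = 1"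
    by (rule C1_cutoff_exists) blast
  define k where "k u = of_real (\<rho> (Re u - a)) * l u" for u
  \<comment> \<open>Nothing is known about \<open>l\<close> for \<open>Re u \<le> a - 1\<close>, but
    the cutoff already vanishes for \<open>Re u \<le> a\<close>. Splitting in between, at
    \<open>a - 1/2\<close>, leaves room for the Cauchy discs on the right.\<close>
  define P where "P u = (if Re u < a - 1/2 then 0
      else of_real (\<rho> (Re u - a)) * deriv l u + of_real (\<rho>' (Re u - a)) * l u / 2)" for u
  define Q where "Q u = (if Re u < a - 1/2 then 0 else of_real (\<rho>' (Re u - a)) * l u / 2)" for u
  have op: "open {u. Re u > a - 1}" "open {u. Re u < a}"
    by (simp_all add: open_halfspace_Re_gt open_halfspace_Re_lt)
  have dl: "cmod (deriv l u) \<le> 1/8" if "\<not> Re u < a - 1/2" for u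
  proof -
    have sub: "cball u (1/3) \<subseteq> {u. Re u > a - 1}"
    proof
      fix v assume "v \<in> cball u (1/3)"
      then have "\<bar>Re u - Re v\<bar> \<le> 1/3" using abs_Re_le_cmod[of "u - v"] by (simp add: dist_norm)
      then show "v \<in> {u. Re u > a - 1}" unfolding mem_Collect_eq using that by linarith
    qed
    have "cmod ((deriv ^^ 1) l u) \<le> fact 1 * (1/24) / (1/3) ^ 1"
    proof (rule Cauchy_inequality)
      show "l holomorphic_on ball u (1/3)"
        using hol sub ball_subset_cball by (blast intro: holomorphic_on_subset)
      show "continuous_on (cball u (1/3)) l"
        using holomorphic_on_imp_continuous_on[OF hol] sub by (rule continuous_on_subset)
      fix v assume "cmod (u - v) = 1/3"
      then have "v \<in> cball u (1/3)" by (simp add: dist_norm)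
      then show "cmod (l v) \<le> 1/24" using sub small by blast
    qed simp
    then show ?thesis by simp
  qed
  have "cmod (of_real (\<rho> (Re u - a)) * deriv l u) \<le> 1/8"
       "cmod (of_real (\<rho>' (Re u - a)) * l u / 2) \<le> 1/16" if "\<not> Re u < a - 1/2" for u
    using mult_mono[OF \<rho>(2)[of "Re u - a"] dl[OF that]] mult_mono[OF small[of u] \<rho>(3)[of "Re u - a"]] that
    by (simp_all add: norm_mult norm_divide)
  note bounds = this
  show ?thesis
  proof (rule that[of k P Q])
    fix u
    show "(k has_derivative (\<lambda>v. P u * v + Q u * cnj v)) (at u)"
    proof (cases "Re u < a - 1/2")
      case True
      have "((\<lambda>_. 0) has_derivative (\<lambda>_. 0)) (at u)" by (rule has_derivative_const)
      then have "(k has_derivative (\<lambda>_. 0)) (at u)"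
        by (rule has_derivative_transform_within_open[OF _ op(2)])
           (use True \<rho>(4) in \<open>auto simp: k_def\<close>)
      then show ?thesis using True by (simp add: P_def Q_def)
    next
      case False
      have "(l has_derivative (\<lambda>v. deriv l u * v)) (at u)"
        using holomorphic_derivI[OF hol op(1), of u] False by (simp add: has_field_derivative_def)
      moreover have "((\<lambda>u. \<rho> (Re u - a)) has_derivative (\<lambda>v. \<rho>' (Re u - a) * Re v)) (at u)"
      proof -
        have "((\<lambda>u. Re u - a) has_derivative Re) (at u)"
          by (auto intro!: derivative_eq_intros)
        from has_derivative_compose[OF this, of \<rho> "(*) (\<rho>' (Re u - a))"] \<rho>(1)
        show ?thesis by (simp add: has_field_derivative_def)
      qed
      ultimately have "(k has_derivative (\<lambda>v. of_real (\<rho> (Re u - a)) * (deriv l u * v)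
            + of_real (\<rho>' (Re u - a) * Re v) * l u)) (at u)"
        unfolding k_def[abs_def]
        by (intro has_derivative_mult has_derivative_of_real)
      moreover have "of_real (\<rho> (Re u - a)) * (deriv l u * v) + of_real (\<rho>' (Re u - a) * Re v) * l u
          = P u * v + Q u * cnj v" for v
      proof -
        \<comment> \<open>This splits the derivative of the cutoff into equal linear and
          conjugate-linear halves; the latter is all of \<open>Q\<close>.\<close>
        have "(of_real (Re v) :: complex) = (v + cnj v) / 2" by (simp add: complex_add_cnj)
        then have "(of_real (\<rho>' (Re u - a) * Re v) :: complex) = of_real (\<rho>' (Re u - a)) * ((v + cnj v) / 2)"
          by (simp only: of_real_mult)
        then show ?thesis using False by (simp only: P_def Q_def if_False) (simp add: algebra_simps add_divide_distrib)
      qed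
      ultimately show ?thesis by simp
    qed
    show "cmod (P u) \<le> 1/4"
    proof (cases "Re u < a - 1/2")
      case False
      show ?thesis
        unfolding P_def if_not_P[OF False]
        by (rule norm_triangle_le) (use bounds[OF False] in linarith)
    qed (simp add: P_def)
    show "cmod (Q u) \<le> 1/4"
    proof (cases "Re u < a - 1/2")
      case False
      show ?thesis
        unfolding Q_def if_not_P[OF False] using bounds(2)[OF False] by linarith
    qed (simp add: Q_def)
    show "k u = 0" if "Re u \<le> a" using that \<rho>(4) by (simp add: k_def)
    show "k u = l u" if "Re u \<ge> a + 1" using that \<rho>(5) by (simp add: k_def)
    show "cmod (k u) \<le> cmod (l u)"
      using mult_right_mono[OF \<rho>(2)[of "Re u - a"] norm_ge_zero[of "l u"]]
      by (simp add: k_def norm_mult)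
  qed
qed

section \<open>Behaviour at infinity\<close>

lemma asymptotically_conformal_if_bounded_displacement:
  assumes "\<And>z. cmod (\<phi> z - z) \<le> K"
  shows "asymptotically_conformal_at_infinity \<phi>"
  unfolding asymptotically_conformal_at_infinity_def
proof (intro exI conjI)
  have "((\<lambda>z. of_real K * inverse z) \<longlongrightarrow> (of_real K * 0 :: complex)) at_infinity"
    by (intro tendsto_mult tendsto_const tendsto_inverse_0)
  then have "((\<lambda>z. norm (of_real K * inverse z :: complex)) \<longlongrightarrow> 0) at_infinity"
    by (simp add: tendsto_norm_zero_iff)
  then have "((\<lambda>z. (\<phi> z - z) * inverse z) \<longlongrightarrow> 0) at_infinity"
  proof (rule Lim_null_comparison[rotated], intro always_eventually allI)
    fix z
    have "cmod (\<phi> z - z) \<le> \<bar>K\<bar>" using assms[of z] by linarith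
    then show "cmod ((\<phi> z - z) * inverse z) \<le> norm (of_real K * inverse z :: complex)"
      by (simp only: norm_mult norm_of_real mult_right_mono norm_ge_zero)
  qed
  then have "((\<lambda>z. 1 + (\<phi> z - z) * inverse z) \<longlongrightarrow> 1 + 0) at_infinity"
    by (intro tendsto_add tendsto_const)
  moreover have "\<forall>\<^sub>F z in at_infinity. 1 + (\<phi> z - z) * inverse z = \<phi> z / z"
    unfolding eventually_at_infinity
  proof (intro exI allI impI)
    fix z :: complex assume "1 \<le> cmod z"
    then have "z \<noteq> 0" by auto
    then show "1 + (\<phi> z - z) * inverse z = \<phi> z / z" by (simp add: field_simps)
  qed
  ultimately show "((\<lambda>z. \<phi> z / z) \<longlongrightarrow> 1) at_infinity"
    by (simp add: tendsto_cong)
qed simp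

text \<open>Turns the sequential escape condition on \<open>\<Psi>\<close> into a uniform one on
  \<open>h\<close>: choosing a counterexample beyond each radius \<open>n\<close> would give a
  sequence tending to infinity with bounded image under \<open>h\<close>.\<close>

lemma inverse_escapes:
  assumes "\<And>z :: nat \<Rightarrow> complex. (\<And>n. z n \<in> T) \<Longrightarrow>
        filterlim (\<lambda>n. \<Psi> (z n)) at_infinity sequentially \<Longrightarrow> filterlim z at_infinity sequentially"
    and h: "\<And>w. w \<in> H \<Longrightarrow> h w \<in> T" "\<And>w. w \<in> H \<Longrightarrow> \<Psi> (h w) = w"
  shows "\<exists>N. \<forall>w\<in>H. cmod w \<ge> N \<longrightarrow> cmod (h w) \<ge> M"
proof (rule ccontr)
  assume "\<not> ?thesis"
  then have "\<forall>n::nat. \<exists>w\<in>H. cmod w \<ge> real n \<and> cmod (h w) < M" by (meson not_le)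
  then obtain w where w: "\<And>n. w n \<in> H" "\<And>n. cmod (w n) \<ge> real n" "\<And>n. cmod (h (w n)) < M"
    by metis
  have "filterlim (\<lambda>n. cmod (w n)) at_top sequentially"
    by (rule filterlim_at_top_mono[OF filterlim_real_sequentially]) (use w in auto)
  then have "filterlim (\<lambda>n. \<Psi> (h (w n))) at_infinity sequentially"
    using w(1) h(2) by (simp add: filterlim_at_infinity_conv_norm_at_top)
  then have "filterlim (\<lambda>n. cmod (h (w n))) at_top sequentially"
    using assms(1)[of "\<lambda>n. h (w n)"] w(1) h(1) by (simp add: filterlim_at_infinity_conv_norm_at_top)
  then have "\<forall>\<^sub>F n in sequentially. M \<le> cmod (h (w n))" by (simp add: filterlim_at_top)
  then show False using w(3) by (auto simp: eventually_sequentially not_le[symmetric])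
qed

text \<open>Properness: a convergent sequence in the image is bounded, so it lies in the image of a
  compact part of \<open>S\<close>, which is closed.\<close>

lemma closed_image_if_escapes:
  fixes h :: "complex \<Rightarrow> complex"
  assumes cont: "continuous_on S h" and "closed S"
    and escape: "\<And>M. \<exists>N. \<forall>w\<in>S. cmod w \<ge> N \<longrightarrow> cmod (h w) \<ge> M"
  shows "closed (h ` S)"
  unfolding closed_sequential_limits
proof (intro allI impI, elim conjE)
  fix x l assume x: "\<forall>n. x n \<in> h ` S" "x \<longlonglongrightarrow> l"
  then obtain M where M: "\<And>n. cmod (x n) < M"
    using convergent_imp_bounded[OF x(2)] unfolding bounded_pos_less by auto
  obtain N where N: "\<And>w. w \<in> S \<Longrightarrow> cmod w \<ge> N \<Longrightarrow> cmod (h w) \<ge> M" using escape by blast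
  have "x n \<in> h ` (S \<inter> cball 0 N)" for n
  proof -
    obtain w where "w \<in> S" "x n = h w" using x(1) by blast
    then show ?thesis using N[of w] M[of n] by (cases "cmod w \<le> N") auto
  qed
  moreover have "closed (h ` (S \<inter> cball 0 N))"
    by (rule compact_imp_closed[OF compact_continuous_image[OF continuous_on_subset[OF cont]
          closed_Int_compact[OF \<open>closed S\<close> compact_cball]]]) auto
  ultimately have "l \<in> h ` (S \<inter> cball 0 N)"
    using x(2) unfolding closed_sequential_limits by blast
  then show "l \<in> h ` S" by blast
qed

theorem theorem1p8:
  fixes H T :: "complex set" and \<Psi> g f :: "complex \<Rightarrow> complex"
  assumes "H = {z. Re z > - 14 * log_plus \<bar>Im z\<bar>}"
    and "model_function \<Psi> T H"
    and "\<And>z. z \<in> T \<Longrightarrow> g z = exp (\<Psi> z)"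
    and "f \<in> eremenko_lyubich_class"
    and "(\<lambda>z. f z - g z) \<in> O[inf at_infinity (principal T)](\<lambda>z. 1 / z)"
    and "f \<in> O[inf at_infinity (principal (- T))](\<lambda>z. 1 / z)"
  shows "\<forall>\<^sub>F R :: real in at_top. \<exists>\<phi> :: complex \<Rightarrow> complex.
           quasiconformal UNIV UNIV \<phi> \<and>
           (\<forall>z\<in>T. cmod (g z) \<ge> R \<longrightarrow> g z = f (\<phi> z)) \<and>
           asymptotically_conformal_at_infinity \<phi> \<and>
           (\<lambda>z. \<phi> z - z) \<in> O[at_infinity](\<lambda>z. 1)"
proof -

  \<comment> \<open>The chart and the choice of constants\<close>
  have f: "f holomorphic_on UNIV"
    using assms(4) by (simp add: eremenko_lyubich_class_def transcendental_entire_def)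
  have T: "open T" and H: "open H" "{z. Re z > 0} \<subseteq> H"
    and \<Psi>: "\<Psi> holomorphic_on T" "bij_betw \<Psi> T H"
    and escape: "\<And>z :: nat \<Rightarrow> complex. (\<And>n. z n \<in> T) \<Longrightarrow>
        filterlim (\<lambda>n. \<Psi> (z n)) at_infinity sequentially \<Longrightarrow> filterlim z at_infinity sequentially"
    using assms(2) unfolding model_function_def conformal_isomorphism_def by blast+
  have \<Psi>H: "\<Psi> ` T = H" and inj\<Psi>: "inj_on \<Psi> T" using \<Psi>(2) by (auto simp: bij_betw_def)
  obtain h where hol_h: "h holomorphic_on H" and h\<Psi>: "\<And>z. z \<in> T \<Longrightarrow> h (\<Psi> z) = z"
    using holomorphic_has_inverse[OF \<Psi>(1) T inj\<Psi>] \<Psi>H by metis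
  have hT: "h w \<in> T" and \<Psi>h: "\<Psi> (h w) = w" if "w \<in> H" for w
    using that \<Psi>H h\<Psi> by auto
  have inj_h: "inj_on h H" by (metis inj_onI \<Psi>h)
  note h_escapes = inverse_escapes[of T \<Psi> H h, OF escape hT \<Psi>h]

  \<comment> \<open>Any point of \<open>H\<close> outside the right half-plane gives a value omitted
    there by injectivity. The point \<open>\<i>\<close> itself would not do:
    \<open>log_plus 1 = 0\<close> puts it outside \<open>H\<close>.\<close>
  define p where "p = h (3 * \<i>)"
  have "3 * \<i> \<in> H" by (simp add: assms(1) log_plus_def)
  then have p: "p \<notin> h ` {w. Re w > 0}"
    using inj_h H(2) unfolding p_def inj_on_def by force

  obtain C where C: "C > 0"
      "\<forall>\<^sub>F z in inf at_infinity (principal T). cmod (f z - g z) \<le> C * cmod (1 / z)"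
    using landau_o.bigE[OF assms(5)] by blast
  then obtain M where M: "\<And>z. z \<in> T \<Longrightarrow> cmod z \<ge> M \<Longrightarrow> cmod (f z - g z) \<le> C * cmod (1 / z)"
    unfolding eventually_inf_principal eventually_at_infinity by blast
  obtain N where N: "\<And>w. w \<in> H \<Longrightarrow> cmod w \<ge> N \<Longrightarrow> cmod (h w) \<ge> max M 1"
    using h_escapes[of "max M 1"] by blast
  \<comment> \<open>The first bound makes the estimates available for \<open>Re u > a - 1\<close>,
    the second keeps unit discs about points with \<open>Re u > a\<close> in the right half-plane,
    and the third gives \<open>C * exp (1 - a) \<le> 1/48\<close>.\<close>
  define a where "a = max (max (N + 1) 2) (1 + ln (48 * C))"
  have a: "N \<le> a - 1" "a \<ge> 2" "1 + ln (48 * C) \<le> a" by (auto simp: a_def)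
  have "C * exp (1 - a) \<le> C * exp (- ln (48 * C))"
    using a(3) C(1) by (intro mult_left_mono) auto
  also have "\<dots> = 1/48" using C(1) by (simp add: exp_minus)
  finally have Ca: "C * exp (1 - a) \<le> 1/48" .

  \<comment> \<open>The logarithmic error\<close>
  \<comment> \<open>The relative error, \<open>f (h u) = exp u * (1 + e u)\<close>. Its bound keeps
    the factor \<open>1 / cmod (h u)\<close>, which later cancels the growth of
    \<open>h\<close>.\<close>
  define e where "e u = (f (h u) - exp u) * exp (- u)" for u
  have inH: "u \<in> H" if "Re u > a - 1" for u using that a(2) H(2) by auto
  have h1: "cmod (h u) \<ge> 1" and e: "cmod (e u) \<le> 1/48 / cmod (h u)" if u: "Re u > a - 1" for u
  proof -
    have "cmod u \<ge> N" using u a(1) complex_Re_le_cmod[of u] by linarith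
    then have hu: "cmod (h u) \<ge> M" "cmod (h u) \<ge> 1" using N[OF inH[OF u]] by auto
    then have "cmod (f (h u) - exp u) \<le> C * cmod (1 / h u)"
      using M[OF hT[OF inH[OF u]]] assms(3)[OF hT[OF inH[OF u]]] \<Psi>h[OF inH[OF u]] by simp
    moreover have "cmod (exp (- u)) \<le> exp (1 - a)" using u by simp
    ultimately have "cmod (e u) \<le> (C * cmod (1 / h u)) * exp (1 - a)"
      unfolding e_def norm_mult using C(1) by (intro mult_mono) auto
    also have "\<dots> = (C * exp (1 - a)) * cmod (1 / h u)" by simp
    also have "\<dots> \<le> 1/48 * cmod (1 / h u)" by (rule mult_right_mono[OF Ca norm_ge_zero])
    finally show "cmod (e u) \<le> 1/48 / cmod (h u)" by (simp add: norm_divide)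
    show "cmod (h u) \<ge> 1" by fact
  qed
  have e': "cmod (e u) \<le> 1/48" if "Re u > a - 1" for u
    using order_trans[OF e[OF that] frac_le[of "1/48" "1/48" 1]] h1[OF that] by simp
  have e_pos: "Re (1 + e u) > 0" if "Re u > a - 1" for u
    using e'[OF that] abs_Re_le_cmod[of "e u"] by simp

  define l where "l u = Ln (1 + e u)" for u
  have hol_l: "l holomorphic_on {u. Re u > a - 1}"
  proof -
    have "h holomorphic_on {u. Re u > a - 1}"
      using hol_h inH by (blast intro: holomorphic_on_subset)
    then have "(f \<circ> h) holomorphic_on {u. Re u > a - 1}"
      using f by (intro holomorphic_on_compose) (auto intro: holomorphic_on_subset)
    then have "e holomorphic_on {u. Re u > a - 1}"
      unfolding e_def[abs_def] o_def by (intro holomorphic_intros)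
    then show ?thesis
      unfolding l_def[abs_def]
      by (intro holomorphic_intros) (use e_pos in \<open>force simp: complex_nonpos_Reals_iff\<close>)
  qed
  \<comment> \<open>Taking \<open>Ln\<close> costs a factor \<open>2\<close>, so the bound
    \<open>1/48\<close> for \<open>e\<close> yields the \<open>1/24\<close> required by
    \<open>holomorphic_cutoff\<close>.\<close>
  have l: "cmod (l u) \<le> 1/24 / cmod (h u)" if "Re u > a - 1" for u
    using norm_Ln_le[of "e u"] e[OF that] e'[OF that] unfolding l_def by simp
  have l': "cmod (l u) \<le> 1/24" if "Re u > a - 1" for u
    using norm_Ln_le[of "e u"] e'[OF that] unfolding l_def by simp
  have fh: "f (h u) = exp (u + l u)" if "Re u > a - 1" for u
  proof -
    have "1 + e u \<noteq> 0" using e_pos[OF that] by (metis less_irrefl zero_complex.sel(1))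
    then show ?thesis by (simp add: l_def exp_add e_def exp_minus field_simps)
  qed

  \<comment> \<open>The map in the half-plane coordinate and its transplant\<close>
  obtain k P Q where k:
      "\<And>u. (k has_derivative (\<lambda>v. P u * v + Q u * cnj v)) (at u)"
      "\<And>u. cmod (P u) \<le> 1/4" "\<And>u. cmod (Q u) \<le> 1/4"
      "\<And>u. Re u \<le> a \<Longrightarrow> k u = 0" "\<And>u. Re u \<ge> a + 1 \<Longrightarrow> k u = l u"
      "\<And>u. Re u > a \<Longrightarrow> cmod (k u) \<le> cmod (l u)"
    by (rule holomorphic_cutoff[OF hol_l l']) blast+
  obtain \<Phi> A B where \<Phi>:
      "homeomorphism UNIV UNIV \<Phi> (\<lambda>u. u + k u)"
      "\<And>w. (\<Phi> has_derivative (\<lambda>v. A w * v + B w * cnj v)) (at w)"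
      "\<And>w. cmod (A w) \<le> 2" "\<And>w. cmod (B w) \<le> 1/2 * cmod (A w)"
    by (rule perturbed_identity_inverse[OF k(1-3)]) blast
  have \<Phi>k: "\<Phi> w + k (\<Phi> w) = w" and k\<Phi>: "\<Phi> (u + k u) = u" for w u
    using \<Phi>(1) by (auto simp: homeomorphism_def)
  have \<Phi>_fix: "\<Phi> w = w" if "Re w \<le> a" for w
    using k\<Phi>[of w] k(4)[OF that] by simp
  \<comment> \<open>If \<open>Re (\<Phi> w) \<le> a\<close>, then \<open>k\<close> vanishes at
    \<open>\<Phi> w\<close>, so \<open>\<Phi> w = w\<close>, a contradiction. The next fact is the
    analogue for the inverse.\<close>
  have \<Phi>_half: "Re (\<Phi> w) > a" if "Re w > a" for w
    using \<Phi>k[of w] k(4)[of "\<Phi> w"] that by (cases "Re (\<Phi> w) > a") auto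
  have k_half: "Re (u + k u) > a" if "Re u > a" for u
    using k\<Phi>[of u] \<Phi>_fix[of "u + k u"] that by (cases "Re (u + k u) > a") auto

  interpret half_plane_chart T H \<Psi> h a
  proof
    show "{w. Re w \<ge> a} \<subseteq> H" using a(2) H(2) by auto
    then show "closed (h ` {w. Re w \<ge> a})"
      using h_escapes
      by (intro closed_image_if_escapes closed_halfspace_Re_ge
          continuous_on_subset[OF holomorphic_on_imp_continuous_on[OF hol_h]]) (auto, blast)
  qed (use T H \<Psi> \<Psi>H hol_h h\<Psi> hT \<Psi>h in auto)

  have qc: "quasiconformal UNIV UNIV (transplant \<Phi>)"
    by (rule quasiconformal_transplant[OF \<Phi>(1) _ _ \<Phi>(2,3) _ _ \<Phi>(4)])
       (use \<Phi>_fix \<Phi>_half k(4) k_half in auto)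

  \<comment> \<open>Bounded displacement\<close>
  \<comment> \<open>The constant of \<open>univalent_increment_le\<close> times
    \<open>1 + cmod p\<close>: \<open>cmod (h u - p)\<close> is at most
    \<open>cmod (h u) * (1 + cmod p)\<close>, and the bound on \<open>k u\<close> removes
    \<open>cmod (h u)\<close>.\<close>
  define D where "D = 24 * pi * exp (12 * pi) * (1 + cmod p)"
  have "D \<ge> 0" by (simp add: D_def)
  have displacement: "cmod (transplant \<Phi> z - z) \<le> D" for z
  proof (cases "z \<in> T \<and> Re (\<Psi> z) > a")
    case True
    define u where "u = \<Phi> (\<Psi> z)"
    have u: "Re u > a" using True \<Phi>_half by (simp add: u_def)
    \<comment> \<open>The displacement is thus an increment of \<open>h\<close> over the step
      \<open>k u\<close>.\<close>
    have eqs: "z = h (u + k u)" "transplant \<Phi> z = h u"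
      using True \<Phi>k[of "\<Psi> z"] h\<Psi> by (simp_all add: u_def transplant_def)
    have kl: "cmod (k u) \<le> 1/24 / cmod (h u)" "cmod (k u) \<le> 1/24"
      using k(6)[OF u] l[of u] l'[of u] u by auto
    have sub: "ball u 1 \<subseteq> {w. Re w > 0}"
    proof
      fix v assume "v \<in> ball u 1"
      then have "Re u - Re v < 1" using complex_Re_le_cmod[of "u - v"] by (simp add: dist_norm)
      then show "v \<in> {w. Re w > 0}" using u a(2) by simp
    qed
    have "cmod (h (u + k u) - h u)
        \<le> 24 * pi * exp (12 * pi) * cmod (h u - p) * cmod (u + k u - u)"
    proof (rule univalent_increment_le)
      show "h holomorphic_on ball u 1" using hol_h sub H(2) by (blast intro: holomorphic_on_subset)
      show "inj_on h (ball u 1)" using inj_h sub H(2) by (blast intro: inj_on_subset)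
      show "p \<notin> h ` ball u 1" using p sub by blast
      show "cmod (u + k u - u) \<le> 1/2" using kl(2) by simp
    qed
    also have "\<dots> = 24 * pi * exp (12 * pi) * (cmod (h u - p) * cmod (k u))" by simp
    also have "\<dots> \<le> 24 * pi * exp (12 * pi) * (1 + cmod p)"
    proof (rule mult_left_mono)
      have hu: "cmod (h u) \<ge> 1" using h1 u by simp
      have "cmod (h u - p) \<le> cmod (h u) + cmod p" by (rule norm_triangle_ineq4)
      also have "\<dots> \<le> cmod (h u) * (1 + cmod p)"
        using mult_right_mono[OF hu, of "cmod p"] by (simp add: algebra_simps)
      finally have "cmod (h u - p) * cmod (k u) \<le> (cmod (h u) * (1 + cmod p)) * (1/24 / cmod (h u))"
        using kl(1) by (intro mult_mono) auto
      also have "\<dots> = (1 + cmod p) / 24"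
      proof -
        have "cmod (h u) \<noteq> 0" using hu by linarith
        then show ?thesis by simp
      qed
      also have "\<dots> \<le> 1 + cmod p" by simp
      finally show "cmod (h u - p) * cmod (k u) \<le> 1 + cmod p" .
    qed simp
    finally show ?thesis
      by (subst eqs(2), subst eqs(1)) (simp add: D_def norm_minus_commute)
  next
    case False
    then have "transplant \<Phi> z = z" using \<Phi>_fix h\<Psi> by (auto simp: transplant_def)
    then show ?thesis using \<open>D \<ge> 0\<close> by simp
  qed

  \<comment> \<open>The functional equation\<close>
  \<comment> \<open>The threshold means \<open>Re (\<Psi> z) \<ge> a + 2\<close>. A shift by at most
    \<open>1\<close> leaves \<open>Re u \<ge> a + 1\<close>, where \<open>k\<close> equals
    \<open>l\<close>.\<close>
  have semiconj: "g z = f (transplant \<Phi> z)" if z: "z \<in> T" "cmod (g z) \<ge> exp (a + 2)" for z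
  proof -
    define u where "u = \<Phi> (\<Psi> z)"
    have w: "Re (\<Psi> z) \<ge> a + 2" using z assms(3) by simp
    then have "Re u > a" using \<Phi>_half by (simp add: u_def)
    then have "cmod (k u) \<le> 1" using k(6)[of u] l'[of u] by simp
    moreover have uk: "u + k u = \<Psi> z" using \<Phi>k by (simp add: u_def)
    then have "Re u + Re (k u) = Re (\<Psi> z)" by (metis plus_complex.sel(1))
    ultimately have "Re u \<ge> a + 1" using w complex_Re_le_cmod[of "k u"] by linarith
    then have "f (h u) = exp (\<Psi> z)" using fh[of u] k(5)[of u] uk by simp
    then show ?thesis using z(1) assms(3) by (simp add: transplant_def u_def)
  qed
  have bigo: "(\<lambda>z. transplant \<Phi> z - z) \<in> O[at_infinity](\<lambda>z. 1)"
    by (rule bigoI[of _ D]) (simp add: displacement)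
  show ?thesis
    unfolding eventually_at_top_linorder
  proof (intro exI[of _ "exp (a + 2)"] allI impI exI[of _ "transplant \<Phi>"] conjI ballI)
    show "g z = f (transplant \<Phi> z)" if "exp (a + 2) \<le> R" "z \<in> T" "R \<le> cmod (g z)" for R z
      using semiconj that by force
  qed (use qc bigo asymptotically_conformal_if_bounded_displacement[OF displacement] in auto)
qed

end
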